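(* Let $\alpha\in\mathfrak S_a$, $\beta\in\mathfrak S_b$ and $\pi=12[\alpha,\beta]$. The map $\eta$ is a bijection from $U_{\alpha,\beta}$ onto $R(\pi)$, and the graph $G_{\alpha,\beta}$ is isomorphic to $G_{\pi}$.
   Context: For $\pi\in\mathfrak S_n$, $R(\pi)$ is the set of reduced words (minimal-length words $r_1\cdots r_\ell$ in $[n-1]$ with $\pi=s_{r_1}\cdots s_{r_\ell}$, $s_i=(i,i+1)$), and $G_\pi$ is the graph on $R(\pi)$ whose edges join words related by one commutation move (exchange adjacent $jk$, $|j-k|>1$) or one long braid move (consecutive $j(j+1)j\leftrightarrow(j+1)j(j+1)$). $12[\alpha,\beta]=\alpha_1\cdots\alpha_a(\beta_1+a)\cdots(\beta_b+a)$. Let $\underline{R}(\alpha)$ be the set of reduced words of $\alpha$ written in the formal alphabet $\{\underline1,\dots,\underline{a-1}\}$ and $\overline{R}(\beta)$ the reduced words of $\beta$ in the disjoint formal alphabet $\{\overline1,\dots,\overline{b-1}\}$. A shuffle of words $u$ and $v$ is a word of length $|u|+|v|$ whose letters can be partitioned into a subsequence equal to $u$ and a complementary subsequence equal to $v$. $U_{\alpha,\beta}$ is the set of all shuffles of some $u\in\underline R(\alpha)$ with some $v\in\overline R(\beta)$. $G_{\alpha,\beta}$ is the graph on $U_{\alpha,\beta}$ with edges joining words obtained from each other by: exchanging adjacent letters $\underline{j}\,\underline{k}$ with $|j-k|>1$; exchanging adjacent $\overline{j}\,\overline{k}$ with $|j-k|>1$; exchanging adjacent $\underline j\,\overline k$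 (or $\overline k\,\underline j$) for any $j,k$; replacing consecutive $\underline j\,\underline{j+1}\,\underline j$ by $\underline{j+1}\,\underline j\,\underline{j+1}$ or vice versa; replacing consecutive $\overline j\,\overline{j+1}\,\overline j$ by $\overline{j+1}\,\overline j\,\overline{j+1}$ or vice versa. The map $\eta$ sends $w=w_1\cdots w_k\in U_{\alpha,\beta}$ to $r=r_1\cdots r_k$ where $r_i=j$ if $w_i=\underline j$ and $r_i=j+a$ if $w_i=\overline j$. *)

theory Defs
  imports
    "HOL-Combinatorics.Permutations"
    "Graph_Theory.Pair_Digraph"
    "Graph_Theory.Digraph_Isomorphism"
begin

text \<open>
  The symmetric group on \<open>n\<close> letters consists of the functions \<open>\<pi>\<close> with \<open>\<pi> permutes {1..n}\<close>.
  Products of permutations are compositions of functions (the right-most factor acts first).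
\<close>

definition simple_transposition :: "nat \<Rightarrow> nat \<Rightarrow> nat" where
  "simple_transposition i = transpose i (i + 1)"

definition word_product :: "nat list \<Rightarrow> nat \<Rightarrow> nat" where
  "word_product r = foldr (\<circ>) (map simple_transposition r) id"

definition reduced_words :: "nat \<Rightarrow> (nat \<Rightarrow> nat) \<Rightarrow> nat list set" where
  "reduced_words n \<pi> =
    {r. is_arg_min length (\<lambda>s. s \<in> lists {1..<n} \<and> word_product s = \<pi>) r}"

inductive word_move :: "nat list \<Rightarrow> nat list \<Rightarrow> bool" where
  commutation: "\<bar>int j - int k\<bar> > 1 \<Longrightarrow> word_move (p @ [j, k] @ q) (p @ [k, j] @ q)"
| braid_up: "word_move (p @ [j, j + 1, j] @ q) (p @ [j + 1, j, j + 1] @ q)"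
| braid_down: "word_move (p @ [j + 1, j, j + 1] @ q) (p @ [j, j + 1, j] @ q)"

text \<open>
  An undirected simple graph is a symmetric, loop-free digraph: an edge joining \<open>u\<close> and \<open>v\<close>
  is the pair of arcs \<open>(u, v)\<close>, \<open>(v, u)\<close>. Both move relations below are symmetric.
\<close>

definition word_graph :: "nat \<Rightarrow> (nat \<Rightarrow> nat) \<Rightarrow> nat list pair_pre_digraph" where
  "word_graph n \<pi> =
    \<lparr>pverts = reduced_words n \<pi>,
     parcs = {(r, s). r \<in> reduced_words n \<pi> \<and> s \<in> reduced_words n \<pi> \<and> word_move r s}\<rparr>"

text \<open>The inflation \<open>12[\<alpha>, \<beta>]\<close>, extended by the identity outside \<open>{1..a + b}\<close>.\<close>

definition inflation12 ::
    "nat \<Rightarrow> nat \<Rightarrow> (nat \<Rightarrow> nat) \<Rightarrow> (nat \<Rightarrow> nat) \<Rightarrow> nat \<Rightarrow> nat" where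
  "inflation12 a b \<alpha> \<beta> i =
    (if i \<in> {1..a} then \<alpha> i
     else if i \<in> {a + 1..a + b} then \<beta> (i - a) + a
     else i)"

text \<open>\<open>Under j\<close> and \<open>Over j\<close> are the underlined and the overlined letter \<open>j\<close>.\<close>

datatype letter = Under nat | Over nat

definition shuffle_words ::
    "nat \<Rightarrow> nat \<Rightarrow> (nat \<Rightarrow> nat) \<Rightarrow> (nat \<Rightarrow> nat) \<Rightarrow> letter list set" where
  "shuffle_words a b \<alpha> \<beta> =
    (\<Union>u \<in> map Under ` reduced_words a \<alpha>. \<Union>v \<in> map Over ` reduced_words b \<beta>. shuffles u v)"

inductive shuffle_move :: "letter list \<Rightarrow> letter list \<Rightarrow> bool" where
  under_commutation: "\<bar>int j - int k\<bar> > 1 \<Longrightarrow>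
    shuffle_move (p @ [Under j, Under k] @ q) (p @ [Under k, Under j] @ q)"
| over_commutation: "\<bar>int j - int k\<bar> > 1 \<Longrightarrow>
    shuffle_move (p @ [Over j, Over k] @ q) (p @ [Over k, Over j] @ q)"
| under_over: "shuffle_move (p @ [Under j, Over k] @ q) (p @ [Over k, Under j] @ q)"
| over_under: "shuffle_move (p @ [Over k, Under j] @ q) (p @ [Under j, Over k] @ q)"
| under_braid_up: "shuffle_move (p @ [Under j, Under (j + 1), Under j] @ q)
    (p @ [Under (j + 1), Under j, Under (j + 1)] @ q)"
| under_braid_down: "shuffle_move (p @ [Under (j + 1), Under j, Under (j + 1)] @ q)
    (p @ [Under j, Under (j + 1), Under j] @ q)"
| over_braid_up: "shuffle_move (p @ [Over j, Over (j + 1), Over j] @ q)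
    (p @ [Over (j + 1), Over j, Over (j + 1)] @ q)"
| over_braid_down: "shuffle_move (p @ [Over (j + 1), Over j, Over (j + 1)] @ q)
    (p @ [Over j, Over (j + 1), Over j] @ q)"

definition shuffle_graph ::
    "nat \<Rightarrow> nat \<Rightarrow> (nat \<Rightarrow> nat) \<Rightarrow> (nat \<Rightarrow> nat) \<Rightarrow> letter list pair_pre_digraph" where
  "shuffle_graph a b \<alpha> \<beta> =
    \<lparr>pverts = shuffle_words a b \<alpha> \<beta>,
     parcs = {(w, x). w \<in> shuffle_words a b \<alpha> \<beta> \<and> x \<in> shuffle_words a b \<alpha> \<beta> \<and> shuffle_move w x}\<rparr>"

definition eta :: "nat \<Rightarrow> letter list \<Rightarrow> nat list" where
  "eta a = map (\<lambda>l. case l of Under j \<Rightarrow> j | Over j \<Rightarrow> j + a)"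

end

theory Submission
  imports Defs
begin

text \<open>
  The key point is that a reduced word of \<open>12[\<alpha>, \<beta>]\<close> does not use the letter \<open>a\<close>. Following the
  one-line notation of the partial products of a word, call a value low if it is at most \<open>a\<close>
  and high otherwise. A letter that swaps two low (two high) values acts as an adjacent
  transposition on the subsequence of low (high) values, and a letter that swaps a low and a high
  value changes neither subsequence. Deleting the mixed swaps thus leaves words for \<open>\<alpha>\<close> and
  \<open>\<beta>\<close>, and the first letter \<open>a\<close> in the word is a mixed swap. So a word containing \<open>a\<close> can be
  shortened, and a reduced word splits into reduced words of \<open>\<alpha>\<close> and \<open>\<beta>\<close>.
\<close>

section \<open>Products of words and one-line notation\<close>

lemma simple_transposition_apply:
  "simple_transposition j x = (if x = j then Suc j else if x = Suc j then j else x)"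
  by (simp add: simple_transposition_def transpose_def)

lemma word_product_Nil [simp]: "word_product [] = id"
  by (simp add: word_product_def)

lemma word_product_Cons [simp]: "word_product (j # r) = simple_transposition j \<circ> word_product r"
  by (simp add: word_product_def)

lemma word_product_append [simp]: "word_product (r @ s) = word_product r \<circ> word_product s"
  by (induction r) auto

lemma simple_transposition_permutes:
  "j \<in> {1..<n} \<Longrightarrow> simple_transposition j permutes {1..n}"
  unfolding simple_transposition_def by (rule permutes_swap_id) auto

lemma word_product_permutes:
  "r \<in> lists {1..<n} \<Longrightarrow> word_product r permutes {1..n}"
proof (induction r)
  case Nil
  then show ?case using permutes_id[of "{1..n}"] by (simp add: id_def)
next
  case (Cons j r)
  then show ?case
    using permutes_compose[of "word_product r" "{1..n}" "simple_transposition j"]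
      simple_transposition_permutes[of j n] by (simp add: comp_def)
qed

text \<open>Only the letter \<open>a\<close> moves a value across the border between
  \<open>a\<close> and \<open>a + 1\<close>; every other simple transposition preserves the set of
  values at most \<open>a\<close>.\<close>

lemma word_product_le_iff:
  "a \<notin> set r \<Longrightarrow> word_product r x \<le> a \<longleftrightarrow> x \<le> a"
  by (induction r) (auto simp: simple_transposition_apply)

text \<open>Right multiplication by a simple transposition acts on positions. Positions count from
  1, so the entry following the prefix \<open>xs\<close> has position
  \<open>Suc (length xs)\<close>. The function \<open>f\<close> is arbitrary so that shifted
  one-line notations are covered too.\<close>

lemma map_upt_swap:
  assumes "map f [1..<Suc n] = xs @ x # y # ys"
  shows "map (f \<circ> simple_transposition (Suc (length xs))) [1..<Suc n] = xs @ y # x # ys"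
    and "Suc (length xs) \<in> {1..<n}"
proof -
  have len: "n = Suc (Suc (length xs + length ys))"
    using arg_cong[OF assms, of length] by (simp del: upt_Suc)
  then show "Suc (length xs) \<in> {1..<n}" by simp
  have nth: "f (Suc i) = (xs @ x # y # ys) ! i" if "i < n" for i
    using arg_cong[OF assms, of "\<lambda>zs. zs ! i"] that by (simp del: upt_Suc)
  show "map (f \<circ> simple_transposition (Suc (length xs))) [1..<Suc n] = xs @ y # x # ys"
  proof (rule nth_equalityI)
    fix i assume "i < length (map (f \<circ> simple_transposition (Suc (length xs))) [1..<Suc n])"
    then have i: "i < n" by (simp del: upt_Suc)
    have "(f \<circ> simple_transposition (Suc (length xs))) (Suc i) = (xs @ y # x # ys) ! i"
      using i nth[of i] nth[of "length xs"] nth[of "Suc (length xs)"] len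
      by (auto simp: simple_transposition_apply nth_append nth_Cons split: nat.splits)
    then show "map (f \<circ> simple_transposition (Suc (length xs))) [1..<Suc n] ! i
        = (xs @ y # x # ys) ! i"
      using i by (simp del: upt_Suc)
  qed (use len in \<open>simp del: upt_Suc\<close>)
qed

lemma map_upt_split:
  assumes "j \<in> {1..<n}"
  obtains xs ys where "map f [1..<Suc n] = xs @ f j # f (Suc j) # ys" "Suc (length xs) = j"
proof -
  have "[1..<Suc n] = [1..<j] @ [j..<Suc n]"
    using assms by (metis atLeastLessThan_iff le_add_diff_inverse less_SucI less_imp_le upt_add_eq_append)
  also have "[j..<Suc n] = j # Suc j # [Suc (Suc j)..<Suc n]"
    using assms by (simp add: upt_conv_Cons del: upt_Suc)
  finally show ?thesis
    using assms by (intro that[of "map f [1..<j]" "map f [Suc (Suc j)..<Suc n]"])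
      (simp_all del: upt_Suc)
qed

text \<open>Appending the letter \<open>Suc (length xs)\<close> realizes the swap. The outer
  function \<open>g\<close> will be the identity for low values and the shift by \<open>a\<close>
  for high ones.\<close>

lemma map_word_product_swap:
  assumes "u \<in> lists {1..<n}" "map (g \<circ> word_product u) [1..<Suc n] = xs @ x # y # ys"
  obtains u' where "u' \<in> lists {1..<n}" "length u' = Suc (length u)"
    "map (g \<circ> word_product u') [1..<Suc n] = xs @ y # x # ys"
  using assms map_upt_swap[OF assms(2)]
  by (intro that[of "u @ [Suc (length xs)]"]) (auto simp: comp_assoc)

section \<open>Splitting a word into its low and high parts\<close>

lemma upt_add_shift: "[1..<Suc (a + b)] = [1..<Suc a] @ map (\<lambda>x. x + a) [1..<Suc b]"
  by (induction b) auto

text \<open>This is stated for arbitrary words because a prefix of a word for an inflation need not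
  represent an inflation. The \<open>of_bool\<close> summand records the letter saved when
  \<open>a\<close> first occurs.\<close>

lemma split_word:
  assumes "r \<in> lists {1..<a + b}"
  shows "\<exists>u v. u \<in> lists {1..<a} \<and> v \<in> lists {1..<b} \<and>
    filter (\<lambda>x. x \<le> a) (map (word_product r) [1..<Suc (a + b)])
      = map (id \<circ> word_product u) [1..<Suc a] \<and>
    filter (\<lambda>x. a < x) (map (word_product r) [1..<Suc (a + b)])
      = map ((\<lambda>x. x + a) \<circ> word_product v) [1..<Suc b] \<and>
    length u + length v + of_bool (a \<in> set r) \<le> length r"
  using assms
\<comment> \<open>Letters are added on the right, since there a new letter \<open>j\<close> merely
  exchanges the entries in positions \<open>j\<close> and \<open>j + 1\<close>.\<close>
proof (induction r rule: rev_induct)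
  case Nil
  have "filter (\<lambda>x. x \<le> a) [1..<Suc (a + b)] = [1..<Suc a]"
    "filter (\<lambda>x. a < x) [1..<Suc (a + b)] = map (\<lambda>x. x + a) [1..<Suc b]"
    unfolding upt_add_shift
    by (auto simp: filter_empty_conv filter_id_conv simp del: upt_Suc)
  then show ?case
    by (intro exI[of _ "[]"]) (simp del: upt_Suc)
next
  case (snoc j p)
  then have j: "j \<in> {1..<a + b}" and p: "p \<in> lists {1..<a + b}" by auto
  from snoc.IH[OF p] obtain u v where
    u: "u \<in> lists {1..<a}" and v: "v \<in> lists {1..<b}"
    and fu: "filter (\<lambda>x. x \<le> a) (map (word_product p) [1..<Suc (a + b)])
      = map (id \<circ> word_product u) [1..<Suc a]"
    and fv: "filter (\<lambda>x. a < x) (map (word_product p) [1..<Suc (a + b)])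
      = map ((\<lambda>x. x + a) \<circ> word_product v) [1..<Suc b]"
    and len: "length u + length v + of_bool (a \<in> set p) \<le> length p"
    by blast
  define x y where "x = word_product p j" and "y = word_product p (Suc j)"
  obtain xs ys where split: "map (word_product p) [1..<Suc (a + b)] = xs @ x # y # ys"
    and xs: "Suc (length xs) = j"
    using map_upt_split[OF j] unfolding x_def y_def by metis
  have swap: "map (word_product (p @ [j])) [1..<Suc (a + b)] = xs @ y # x # ys"
    using map_upt_swap(1)[OF split] xs by simp
  \<comment> \<open>Before the first \<open>a\<close>, positions up to \<open>a\<close> hold low
    values and later ones high values, so the first \<open>a\<close> is a mixed swap. Hence in the
    two unmixed cases below the \<open>of_bool\<close> term does not grow.\<close>
  have crossing: "x \<le> a \<and> a < y" if "a \<notin> set p" "j = a"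
    using word_product_le_iff[OF that(1), of j] word_product_le_iff[OF that(1), of "Suc j"] that(2)
    unfolding x_def y_def by auto
  \<comment> \<open>For a mixed swap \<open>u\<close> and \<open>v\<close> stay the same, so the
    length of the new letter pays for a possible increase of \<open>of_bool\<close>.\<close>
  have len': "length u + length v + of_bool (a \<in> set (p @ [j])) \<le> length (p @ [j])"
    using len by (simp add: of_bool_def split: if_splits)
  consider (low) "x \<le> a" "y \<le> a" | (high) "a < x" "a < y" | (mixed) "(x \<le> a) \<noteq> (y \<le> a)"
    by linarith
  then show ?case
  proof cases
    case low
    then have "map (id \<circ> word_product u) [1..<Suc a]
        = filter (\<lambda>x. x \<le> a) xs @ x # y # filter (\<lambda>x. x \<le> a) ys"
      using fu unfolding split by simp
    then obtain u' where u': "u' \<in> lists {1..<a}" "length u' = Suc (length u)"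
      and fu': "map (id \<circ> word_product u') [1..<Suc a]
        = filter (\<lambda>x. x \<le> a) xs @ y # x # filter (\<lambda>x. x \<le> a) ys"
      using map_word_product_swap[OF u] by metis
    have "filter (\<lambda>x. x \<le> a) (xs @ y # x # ys) = map (id \<circ> word_product u') [1..<Suc a]"
      unfolding fu' using low by simp
    moreover have "filter (\<lambda>x. a < x) (xs @ y # x # ys)
        = map ((\<lambda>x. x + a) \<circ> word_product v) [1..<Suc b]"
      unfolding fv[symmetric] split using low by simp
    moreover have "length u' + length v + of_bool (a \<in> set (p @ [j])) \<le> length (p @ [j])"
      using u'(2) len crossing low by (auto simp: of_bool_def split: if_splits)
    ultimately show ?thesis
      unfolding swap using u'(1) v by blast
  next
    case high
    then have "map ((\<lambda>x. x + a) \<circ> word_product v) [1..<Suc b]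
        = filter (\<lambda>x. a < x) xs @ x # y # filter (\<lambda>x. a < x) ys"
      using fv unfolding split by simp
    then obtain v' where v': "v' \<in> lists {1..<b}" "length v' = Suc (length v)"
      and fv': "map ((\<lambda>x. x + a) \<circ> word_product v') [1..<Suc b]
        = filter (\<lambda>x. a < x) xs @ y # x # filter (\<lambda>x. a < x) ys"
      using map_word_product_swap[OF v] by metis
    have "filter (\<lambda>x. a < x) (xs @ y # x # ys)
        = map ((\<lambda>x. x + a) \<circ> word_product v') [1..<Suc b]"
      unfolding fv' using high by simp
    moreover have "filter (\<lambda>x. x \<le> a) (xs @ y # x # ys) = map (id \<circ> word_product u) [1..<Suc a]"
      unfolding fu[symmetric] split using high by simp
    moreover have "length u + length v' + of_bool (a \<in> set (p @ [j])) \<le> length (p @ [j])"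
      using v'(2) len crossing high by (auto simp: of_bool_def split: if_splits)
    ultimately show ?thesis
      unfolding swap using u v'(1) by blast
  next
    case mixed
    have "filter (\<lambda>x. x \<le> a) (xs @ y # x # ys) = map (id \<circ> word_product u) [1..<Suc a]"
      unfolding fu[symmetric] split using mixed by auto
    moreover have "filter (\<lambda>x. a < x) (xs @ y # x # ys)
        = map ((\<lambda>x. x + a) \<circ> word_product v) [1..<Suc b]"
      unfolding fv[symmetric] split using mixed by auto
    ultimately show ?thesis
      unfolding swap using u v len' by blast
  qed
qed

lemma permutes_eqI:
  assumes "f permutes S" "g permutes S" "\<And>x. x \<in> S \<Longrightarrow> f x = g x"
  shows "f = g"
  using assms by (metis ext permutes_not_in)

text \<open>The one-line notation of the inflation is that of \<alpha> followed by that of \<beta>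
  shifted by \<open>a\<close>, so its low and high subsequences are exactly these two
  blocks.\<close>

lemma split_word_inflation12:
  assumes \<alpha>: "\<alpha> permutes {1..a}" and \<beta>: "\<beta> permutes {1..b}"
    and r: "r \<in> lists {1..<a + b}" "word_product r = inflation12 a b \<alpha> \<beta>"
  obtains u v where "u \<in> lists {1..<a}" "v \<in> lists {1..<b}"
    "word_product u = \<alpha>" "word_product v = \<beta>"
    "length u + length v + of_bool (a \<in> set r) \<le> length r"
proof -
  from split_word[OF r(1)] obtain u v where
    u: "u \<in> lists {1..<a}" and v: "v \<in> lists {1..<b}"
    and fu: "filter (\<lambda>x. x \<le> a) (map (word_product r) [1..<Suc (a + b)])
      = map (id \<circ> word_product u) [1..<Suc a]"
    and fv: "filter (\<lambda>x. a < x) (map (word_product r) [1..<Suc (a + b)])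
      = map ((\<lambda>x. x + a) \<circ> word_product v) [1..<Suc b]"
    and len: "length u + length v + of_bool (a \<in> set r) \<le> length r"
    by blast
  have \<alpha>_le: "\<alpha> x \<le> a" if "x \<in> {1..a}" for x
    using permutes_in_image[OF \<alpha>, of x] that by simp
  have \<beta>_ge: "1 \<le> \<beta> x" if "x \<in> {1..b}" for x
    using permutes_in_image[OF \<beta>, of x] that by simp
  have "map (word_product r) [1..<Suc (a + b)]
      = map \<alpha> [1..<Suc a] @ map (\<lambda>x. \<beta> x + a) [1..<Suc b]"
    unfolding upt_add_shift by (auto simp: r(2) inflation12_def simp del: upt_Suc)
  moreover have "filter (\<lambda>x. x \<le> a) (map \<alpha> [1..<Suc a]) = map \<alpha> [1..<Suc a]"
    "filter (\<lambda>x. a < x) (map \<alpha> [1..<Suc a]) = []"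
    using \<alpha>_le by (auto simp: filter_id_conv filter_empty_conv not_less simp del: upt_Suc)
  moreover have "filter (\<lambda>x. a < x) (map (\<lambda>x. \<beta> x + a) [1..<Suc b]) = map (\<lambda>x. \<beta> x + a) [1..<Suc b]"
    "filter (\<lambda>x. x \<le> a) (map (\<lambda>x. \<beta> x + a) [1..<Suc b]) = []"
    using \<beta>_ge by (fastforce simp: filter_id_conv filter_empty_conv not_le simp del: upt_Suc)+
  ultimately have "map \<alpha> [1..<Suc a] = map (word_product u) [1..<Suc a]"
    "map (\<lambda>x. \<beta> x + a) [1..<Suc b] = map (\<lambda>x. word_product v x + a) [1..<Suc b]"
    using fu fv by (simp_all add: comp_def del: upt_Suc)
  then have "\<And>x. x \<in> {1..a} \<Longrightarrow> word_product u x = \<alpha> x"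
    and "\<And>x. x \<in> {1..b} \<Longrightarrow> word_product v x = \<beta> x"
    by (auto simp del: upt_Suc)
  then have "word_product u = \<alpha>" "word_product v = \<beta>"
    using permutes_eqI word_product_permutes u v \<alpha> \<beta> by metis+
  with u v len that show ?thesis by blast
qed

section \<open>Words over the two alphabets and the map \<open>eta\<close>\<close>

fun unders :: "letter list \<Rightarrow> nat list" where
  "unders [] = []"
| "unders (Under j # w) = j # unders w"
| "unders (Over j # w) = unders w"

fun overs :: "letter list \<Rightarrow> nat list" where
  "overs [] = []"
| "overs (Under j # w) = overs w"
| "overs (Over j # w) = j # overs w"

text \<open>The bounds make \<open>eta\<close> injective: without them \<open>Under (j + a)\<close>
  and \<open>Over j\<close> would have the same image.\<close>

definition letters :: "nat \<Rightarrow> nat \<Rightarrow> letter set" where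
  "letters a b = Under ` {1..<a} \<union> Over ` {1..<b}"

lemma letters_simps [simp]:
  "Under j \<in> letters a b \<longleftrightarrow> j \<in> {1..<a}"
  "Over j \<in> letters a b \<longleftrightarrow> j \<in> {1..<b}"
  by (auto simp: letters_def)

lemma eta_simps [simp]:
  "eta a [] = []"
  "eta a (Under j # w) = j # eta a w"
  "eta a (Over j # w) = (j + a) # eta a w"
  by (simp_all add: eta_def)

lemma length_eta [simp]: "length (eta a w) = length w"
  by (simp add: eta_def)

lemma eta_append [simp]: "eta a (w @ x) = eta a w @ eta a x"
  by (simp add: eta_def)

lemma length_unders_overs: "length w = length (unders w) + length (overs w)"
  by (induction w rule: unders.induct) auto

lemma unders_append [simp]: "unders (w @ x) = unders w @ unders x"
  by (induction w rule: unders.induct) auto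

lemma overs_append [simp]: "overs (w @ x) = overs w @ overs x"
  by (induction w rule: overs.induct) auto

lemma unders_map [simp]: "unders (map Under u) = u" "unders (map Over u) = []"
  by (induction u) auto

lemma overs_map [simp]: "overs (map Under u) = []" "overs (map Over u) = u"
  by (induction u) auto

lemma lists_letters_iff:
  "w \<in> lists (letters a b) \<longleftrightarrow> unders w \<in> lists {1..<a} \<and> overs w \<in> lists {1..<b}"
  by (induction w rule: unders.induct) auto

text \<open>The alphabets are disjoint, so each letter reveals which factor it comes from and the
  decomposition of a shuffle is unique. Membership in \<open>shuffle_words\<close> thereby becomes a
  condition on two projections.\<close>

lemma in_shuffles_map_iff:
  "w \<in> shuffles (map Under u) (map Over v) \<longleftrightarrow> unders w = u \<and> overs w = v"
proof
  assume "w \<in> shuffles (map Under u) (map Over v)"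
  then show "unders w = u \<and> overs w = v"
  proof (induction w arbitrary: u v)
    case (Cons l w)
    then show ?case by (auto simp: Cons_in_shuffles_iff map_tl[symmetric] hd_map; cases u; cases v; force)
  qed auto
next
  assume "unders w = u \<and> overs w = v"
  then show "w \<in> shuffles (map Under u) (map Over v)"
    by (induction w arbitrary: u v rule: unders.induct)
      (auto intro: Cons_in_shuffles_leftI Cons_in_shuffles_rightI)
qed

lemma shuffle_words_iff:
  "w \<in> shuffle_words a b \<alpha> \<beta> \<longleftrightarrow> unders w \<in> reduced_words a \<alpha> \<and> overs w \<in> reduced_words b \<beta>"
  by (auto simp: shuffle_words_def in_shuffles_map_iff)

lemma reduced_words_iff:
  "r \<in> reduced_words n \<pi> \<longleftrightarrow> r \<in> lists {1..<n} \<and> word_product r = \<pi> \<and>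
    (\<forall>s. s \<in> lists {1..<n} \<longrightarrow> word_product s = \<pi> \<longrightarrow> length r \<le> length s)"
  by (auto simp: reduced_words_def is_arg_min_linorder)

lemma shuffle_words_in_letters: "shuffle_words a b \<alpha> \<beta> \<subseteq> lists (letters a b)"
  by (rule subsetI) (simp add: shuffle_words_iff lists_letters_iff reduced_words_iff del: in_lists_conv_set)

lemma eta_in_lists: "w \<in> lists (letters a b) \<Longrightarrow> eta a w \<in> lists {1..<a + b}"
  by (induction w rule: unders.induct) auto

lemma inj_on_eta: "inj_on (eta a) (lists (letters a b))"
proof -
  have "inj_on (\<lambda>l. case l of Under j \<Rightarrow> j | Over j \<Rightarrow> j + a) (letters a b)"
    by (auto simp: inj_on_def letters_def)
  then show ?thesis
    unfolding eta_def by (rule inj_on_mapI[OF inj_on_subset]) auto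
qed

text \<open>Letters below \<open>a\<close> lift to \<open>Under\<close> and letters above
  \<open>a\<close> to \<open>Over\<close>; only \<open>a\<close> itself could lack a
  preimage.\<close>

lemma eta_surj:
  "r \<in> lists {1..<a + b} \<Longrightarrow> a \<notin> set r \<Longrightarrow> \<exists>w \<in> lists (letters a b). eta a w = r"
proof (induction r)
  case (Cons j r)
  then obtain w where w: "w \<in> lists (letters a b)" "eta a w = r" by auto
  show ?case
  proof (cases "j < a")
    case True
    with Cons.prems w show ?thesis by (intro bexI[of _ "Under j # w"]) auto
  next
    case False
    with Cons.prems w show ?thesis by (intro bexI[of _ "Over (j - a) # w"]) auto
  qed
qed (auto intro: bexI[of _ "[]"])

section \<open>Products and minimal lengths under \<open>eta\<close>\<close>

lemma inflation12_under:
  assumes "j \<in> {1..<a}" "\<beta> permutes {1..b}"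
  shows "simple_transposition j \<circ> inflation12 a b \<alpha> \<beta>
    = inflation12 a b (simple_transposition j \<circ> \<alpha>) \<beta>"
proof
  fix i
  show "(simple_transposition j \<circ> inflation12 a b \<alpha> \<beta>) i
      = inflation12 a b (simple_transposition j \<circ> \<alpha>) \<beta> i"
    \<comment> \<open>The entries of the upper block exceed \<open>a\<close> because \<beta> maps
      {1..b} to itself, so a transposition of values at most \<open>a\<close> fixes them.\<close>
    using assms permutes_in_image[OF assms(2), of "i - a"]
    by (auto simp: inflation12_def simple_transposition_apply)
qed

lemma inflation12_over:
  assumes "j \<in> {1..<b}" "\<alpha> permutes {1..a}"
  shows "simple_transposition (j + a) \<circ> inflation12 a b \<alpha> \<beta>
    = inflation12 a b \<alpha> (simple_transposition j \<circ> \<beta>)"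
proof
  fix i
  show "(simple_transposition (j + a) \<circ> inflation12 a b \<alpha> \<beta>) i
      = inflation12 a b \<alpha> (simple_transposition j \<circ> \<beta>) i"
    using assms permutes_in_image[OF assms(2), of i]
    by (auto simp: inflation12_def simple_transposition_apply)
qed

text \<open>Each letter multiplies from the left and affects the values of one block only, so the
  interleaving of the two kinds of letters is irrelevant to the product.\<close>

lemma word_product_eta:
  "w \<in> lists (letters a b) \<Longrightarrow>
    word_product (eta a w) = inflation12 a b (word_product (unders w)) (word_product (overs w))"
proof (induction w rule: unders.induct)
  case 1
  show ?case by (auto simp: inflation12_def)
next
  case (2 j w)
  then have "j \<in> {1..<a}" "w \<in> lists (letters a b)" by auto
  moreover from this have "word_product (overs w) permutes {1..b}"
    by (intro word_product_permutes) (simp add: lists_letters_iff)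
  ultimately show ?case
    by (simp only: eta_simps unders.simps overs.simps word_product_Cons 2 inflation12_under)
next
  case (3 j w)
  then have "j \<in> {1..<b}" "w \<in> lists (letters a b)" by auto
  moreover from this have "word_product (unders w) permutes {1..a}"
    by (intro word_product_permutes) (simp add: lists_letters_iff)
  ultimately show ?case
    by (simp only: eta_simps unders.simps overs.simps word_product_Cons 3 inflation12_over)
qed

lemma inflation12_inject:
  assumes "\<alpha> permutes {1..a}" "\<alpha>' permutes {1..a}" "\<beta> permutes {1..b}" "\<beta>' permutes {1..b}"
    and eq: "inflation12 a b \<alpha> \<beta> = inflation12 a b \<alpha>' \<beta>'"
  shows "\<alpha> = \<alpha>'" "\<beta> = \<beta>'"
proof -
  have "\<alpha> x = \<alpha>' x" if "x \<in> {1..a}" for x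
    using fun_cong[OF eq, of x] that by (simp add: inflation12_def)
  then show "\<alpha> = \<alpha>'" using permutes_eqI assms by metis
  have "\<beta> x = \<beta>' x" if "x \<in> {1..b}" for x
    using fun_cong[OF eq, of "x + a"] that by (simp add: inflation12_def)
  then show "\<beta> = \<beta>'" using permutes_eqI assms by metis
qed

text \<open>Concatenation is the simplest shuffle. It bounds the minimal length for the inflation
  from above by the sum of the lengths of words for the two factors.\<close>

lemma eta_append_words:
  assumes "u \<in> lists {1..<a}" "v \<in> lists {1..<b}"
  shows "eta a (map Under u @ map Over v) \<in> lists {1..<a + b}"
    and "word_product (eta a (map Under u @ map Over v))
      = inflation12 a b (word_product u) (word_product v)"
proof -
  have w: "map Under u @ map Over v \<in> lists (letters a b)"
    using assms by (simp add: lists_letters_iff del: append_in_lists_conv)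
  show "eta a (map Under u @ map Over v) \<in> lists {1..<a + b}"
    using eta_in_lists[OF w] .
  show "word_product (eta a (map Under u @ map Over v))
      = inflation12 a b (word_product u) (word_product v)"
    using word_product_eta[OF w] by (simp del: eta_append word_product_append)
qed

text \<open>Minimal lengths add up under inflation: concatenation gives the upper bound and
  splitting the lower one.\<close>

lemma eta_reduced_iff:
  assumes \<alpha>: "\<alpha> permutes {1..a}" and \<beta>: "\<beta> permutes {1..b}" and w: "w \<in> lists (letters a b)"
  shows "eta a w \<in> reduced_words (a + b) (inflation12 a b \<alpha> \<beta>) \<longleftrightarrow> w \<in> shuffle_words a b \<alpha> \<beta>"
proof
  have uv: "unders w \<in> lists {1..<a}" "overs w \<in> lists {1..<b}"
    using w by (simp_all add: lists_letters_iff)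
  {
    assume red: "eta a w \<in> reduced_words (a + b) (inflation12 a b \<alpha> \<beta>)"
    then have "inflation12 a b (word_product (unders w)) (word_product (overs w))
        = inflation12 a b \<alpha> \<beta>"
      by (simp add: reduced_words_iff word_product_eta[OF w])
    then have prod: "word_product (unders w) = \<alpha>" "word_product (overs w) = \<beta>"
      using inflation12_inject word_product_permutes uv \<alpha> \<beta> by metis+
    have min: "length (unders w) + length (overs w) \<le> length u + length v"
      if "u \<in> lists {1..<a}" "v \<in> lists {1..<b}" "word_product u = \<alpha>" "word_product v = \<beta>" for u v
    proof -
      have "length (eta a w) \<le> length (eta a (map Under u @ map Over v))"
        using red eta_append_words[of u a v b] that unfolding reduced_words_iff by blast
      then show ?thesis
        using length_unders_overs[of w] by simp
    qed
    show "w \<in> shuffle_words a b \<alpha> \<beta>"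
      unfolding shuffle_words_iff reduced_words_iff
      \<comment> \<open>Keeping one projection of \<open>w\<close> as competitor and varying the
        other separates the minimality of the sum into minimality of each summand.\<close>
      using uv prod min[OF uv(1) _ prod(1)] min[OF _ uv(2) _ prod(2)]
      by (simp del: in_lists_conv_set)
  next
    assume "w \<in> shuffle_words a b \<alpha> \<beta>"
    then have red: "unders w \<in> reduced_words a \<alpha>" "overs w \<in> reduced_words b \<beta>"
      by (simp_all add: shuffle_words_iff)
    have "length (eta a w) \<le> length s"
      if "s \<in> lists {1..<a + b}" "word_product s = inflation12 a b \<alpha> \<beta>" for s
    proof -
      from split_word_inflation12[OF \<alpha> \<beta> that] obtain u v where
        "u \<in> lists {1..<a}" "v \<in> lists {1..<b}" "word_product u = \<alpha>" "word_product v = \<beta>"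
        "length u + length v + of_bool (a \<in> set s) \<le> length s" .
      moreover from this have "length (unders w) \<le> length u" "length (overs w) \<le> length v"
        using red by (simp_all add: reduced_words_iff)
      ultimately show ?thesis
        using length_unders_overs[of w] by simp
    qed
    then show "eta a w \<in> reduced_words (a + b) (inflation12 a b \<alpha> \<beta>)"
      using red eta_in_lists[OF w] word_product_eta[OF w] by (simp add: reduced_words_iff)
  }
qed

text \<open>If \<open>a\<close> occurred, splitting the word and concatenating the two parts would
  give a strictly shorter word with the same product.\<close>

lemma not_in_reduced_word:
  assumes "\<alpha> permutes {1..a}" "\<beta> permutes {1..b}"
    and r: "r \<in> reduced_words (a + b) (inflation12 a b \<alpha> \<beta>)"
  shows "a \<notin> set r"
proof -
  obtain u v where uv: "u \<in> lists {1..<a}" "v \<in> lists {1..<b}"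
    "word_product u = \<alpha>" "word_product v = \<beta>"
    "length u + length v + of_bool (a \<in> set r) \<le> length r"
    using split_word_inflation12[OF assms(1,2)] r by (metis reduced_words_iff)
  have "length r \<le> length (eta a (map Under u @ map Over v))"
    using r eta_append_words[OF uv(1,2)] uv(3,4) unfolding reduced_words_iff by blast
  then show ?thesis
    using uv(5) by (auto simp: of_bool_def split: if_splits)
qed

lemma bij_betw_eta:
  assumes "\<alpha> permutes {1..a}" "\<beta> permutes {1..b}"
  shows "bij_betw (eta a) (shuffle_words a b \<alpha> \<beta>) (reduced_words (a + b) (inflation12 a b \<alpha> \<beta>))"
  unfolding bij_betw_def
proof (intro conjI equalityI subsetI)
  show "inj_on (eta a) (shuffle_words a b \<alpha> \<beta>)"
    using inj_on_eta shuffle_words_in_letters by (rule inj_on_subset)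
next
  fix r assume "r \<in> eta a ` shuffle_words a b \<alpha> \<beta>"
  then show "r \<in> reduced_words (a + b) (inflation12 a b \<alpha> \<beta>)"
    using eta_reduced_iff[OF assms] shuffle_words_in_letters by blast
next
  fix r assume r: "r \<in> reduced_words (a + b) (inflation12 a b \<alpha> \<beta>)"
  then obtain w where "w \<in> lists (letters a b)" "eta a w = r"
    using eta_surj not_in_reduced_word[OF assms] by (metis reduced_words_iff)
  then show "r \<in> eta a ` shuffle_words a b \<alpha> \<beta>"
    using r eta_reduced_iff[OF assms] by blast
qed

section \<open>Correspondence of the moves\<close>

lemma eta_eq_factorD:
  assumes "eta a w = p @ f @ q"
  obtains p' f' q' where "w = p' @ f' @ q'" "eta a p' = p" "eta a f' = f" "eta a q' = q"
proof -
  obtain p' r where "w = p' @ r" "eta a p' = p" and r: "f @ q = eta a r"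
    using assms unfolding eta_def map_eq_append_conv by blast
  moreover obtain f' q' where "r = f' @ q'" "eta a f' = f" "eta a q' = q"
    using r[symmetric] unfolding eta_def map_eq_append_conv by blast
  ultimately show ?thesis using that by blast
qed

lemma shuffle_move_imp_word_move_eta:
  assumes "shuffle_move w x" "w \<in> lists (letters a b)"
  shows "word_move (eta a w) (eta a x)"
  using assms
proof cases
  case (under_commutation j k p q)
  then show ?thesis using word_move.commutation[of j k "eta a p" "eta a q"] by simp
next
  case (over_commutation j k p q)
  then show ?thesis using word_move.commutation[of "j + a" "k + a" "eta a p" "eta a q"] by simp
next
  \<comment> \<open>Here \<open>j < a\<close> and \<open>1 \<le> k\<close>, so \<open>j\<close> and
    \<open>k + a\<close> differ by at least 2 and the exchange is a legal commutation.\<close>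
  case (under_over p j k q)
  then show ?thesis
    using assms(2) word_move.commutation[of j "k + a" "eta a p" "eta a q"] by simp
next
  case (over_under p k j q)
  then show ?thesis
    using assms(2) word_move.commutation[of "k + a" j "eta a p" "eta a q"] by simp
next
  case (under_braid_up p j q)
  then show ?thesis using word_move.braid_up[of "eta a p" j "eta a q"] by simp
next
  case (under_braid_down p j q)
  then show ?thesis using word_move.braid_down[of "eta a p" j "eta a q"] by simp
next
  case (over_braid_up p j q)
  then show ?thesis using word_move.braid_up[of "eta a p" "j + a" "eta a q"] by simp
next
  case (over_braid_down p j q)
  then show ?thesis using word_move.braid_down[of "eta a p" "j + a" "eta a q"] by simp
qed

lemma eta_eq_pairD:
  assumes "eta a f = [j, k]"
  obtains l m where "f = [l, m]" "eta a [l] = [j]" "eta a [m] = [k]"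
  using assms by (auto simp: eta_def map_eq_Cons_conv)

lemma eta_eq_tripleD:
  assumes "eta a f = [i, j, k]"
  obtains l m n where "f = [l, m, n]" "eta a [l] = [i]" "eta a [m] = [j]" "eta a [n] = [k]"
  using assms by (auto simp: eta_def map_eq_Cons_conv)

lemma shuffle_move_if_word_move_eta:
  assumes move: "word_move (eta a w) (eta a x)"
    and w: "w \<in> lists (letters a b)" and x: "x \<in> lists (letters a b)"
  shows "shuffle_move w x"
proof -
  \<comment> \<open>By injectivity of \<open>eta\<close>, it suffices to exhibit a word over the
    bounded alphabet with the same image as \<open>x\<close>.\<close>
  have lift: "x = p @ g @ q"
    if "w = p @ f @ q" "eta a x = eta a p @ eta a g @ eta a q" "g \<in> lists (letters a b)" for p f g q
  proof (rule inj_onD[OF inj_on_eta])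
    show "p @ g @ q \<in> lists (letters a b)" using that w by simp
  qed (use that x in simp_all)
  from move show ?thesis
  proof cases
    case (commutation j k p q)
    obtain p' f q' where f: "w = p' @ f @ q'" "eta a p' = p" "eta a f = [j, k]" "eta a q' = q"
      using eta_eq_factorD[OF commutation(1)] .
    obtain l m where lm: "f = [l, m]" "eta a [l] = [j]" "eta a [m] = [k]"
      using eta_eq_pairD[OF f(3)] .
    have "x = p' @ [m, l] @ q'"
      using f lm w commutation(2) eta_append[of a "[m]" "[l]"] by (intro lift[OF f(1)]) auto
    \<comment> \<open>For letters of the same kind the shift by \<open>a\<close> cancels in the
      difference; letters of different kinds may always be exchanged.\<close>
    then show ?thesis
      using f(1) lm commutation(3) shuffle_move.under_commutation[of _ _ p' q']
        shuffle_move.over_commutation[of _ _ p' q'] shuffle_move.under_over[of p' _ _ q']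
        shuffle_move.over_under[of p' _ _ q']
      by (cases l; cases m) auto
  next
    case (braid_up p j q)
    obtain p' f q' where f: "w = p' @ f @ q'" "eta a p' = p" "eta a f = [j, j + 1, j]" "eta a q' = q"
      using eta_eq_factorD[OF braid_up(1)] .
    obtain l m n where lm: "f = [l, m, n]" "eta a [l] = [j]" "eta a [m] = [j + 1]" "eta a [n] = [j]"
      using eta_eq_tripleD[OF f(3)] .
    have ln: "l = n" and lm_letters: "l \<in> letters a b" "m \<in> letters a b"
      using lm f(1) w inj_onD[OF inj_on_eta, of a "[l]" "[n]" b] by auto
    have "x = p' @ [m, l, m] @ q'"
      using f lm w braid_up(2) eta_append[of a "[m]" "[l, m]"] eta_append[of a "[l]" "[m]"]
      by (intro lift[OF f(1)]) auto
    \<comment> \<open>The images of \<open>l\<close> and \<open>m\<close> are consecutive, whereas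
      images of letters of different kinds lie on either side of \<open>a\<close>. So
      \<open>l\<close> and \<open>m\<close> are of the same kind.\<close>
    then show ?thesis
      using f(1) lm ln lm_letters shuffle_move.under_braid_up[of p' _ q']
        shuffle_move.over_braid_up[of p' _ q']
      by (cases l; cases m) auto
  next
    case (braid_down p j q)
    obtain p' f q' where f: "w = p' @ f @ q'" "eta a p' = p" "eta a f = [j + 1, j, j + 1]" "eta a q' = q"
      using eta_eq_factorD[OF braid_down(1)] .
    obtain l m n where lm: "f = [l, m, n]" "eta a [l] = [j + 1]" "eta a [m] = [j]" "eta a [n] = [j + 1]"
      using eta_eq_tripleD[OF f(3)] .
    have ln: "l = n" and lm_letters: "l \<in> letters a b" "m \<in> letters a b"
      using lm f(1) w inj_onD[OF inj_on_eta, of a "[l]" "[n]" b] by auto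
    have "x = p' @ [m, l, m] @ q'"
      using f lm w braid_down(2) eta_append[of a "[m]" "[l, m]"] eta_append[of a "[l]" "[m]"]
      by (intro lift[OF f(1)]) auto
    then show ?thesis
      using f(1) lm ln lm_letters shuffle_move.under_braid_down[of p' _ q']
        shuffle_move.over_braid_down[of p' _ q']
      by (cases l; cases m) auto
  qed
qed

section \<open>The bijection and the graph isomorphism\<close>

theorem theorem3p4:
  fixes a b :: nat and \<alpha> \<beta> \<pi> :: "nat \<Rightarrow> nat"
  assumes "\<alpha> permutes {1..a}"
    and "\<beta> permutes {1..b}"
    and "\<pi> = inflation12 a b \<alpha> \<beta>"
  shows "bij_betw (eta a) (shuffle_words a b \<alpha> \<beta>) (reduced_words (a + b) \<pi>)
    \<and> digraph_iso (with_proj (shuffle_graph a b \<alpha> \<beta>)) (with_proj (word_graph (a + b) \<pi>))"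
proof
  let ?U = "shuffle_words a b \<alpha> \<beta>" and ?R = "reduced_words (a + b) \<pi>"
  let ?G = "with_proj (shuffle_graph a b \<alpha> \<beta>)" and ?H = "with_proj (word_graph (a + b) \<pi>)"
  show bij: "bij_betw (eta a) ?U ?R"
    using bij_betw_eta assms by simp
  then have inj: "inj_on (eta a) ?U" and img: "eta a ` ?U = ?R"
    by (auto simp: bij_betw_def)
  have move: "word_move (eta a w) (eta a x) \<longleftrightarrow> shuffle_move w x" if "w \<in> ?U" "x \<in> ?U" for w x
    using shuffle_move_imp_word_move_eta shuffle_move_if_word_move_eta that
      shuffle_words_in_letters by blast
  \<comment> \<open>Arcs are pairs of vertices, so \<open>eta\<close> acts on them componentwise,
    and the head and tail maps of the target are the projections used by
    \<open>with_proj\<close>.\<close>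
  define h where "h = \<lparr>iso_verts = eta a, iso_arcs = map_prod (eta a) (eta a),
    iso_head = snd :: nat list \<times> nat list \<Rightarrow> _, iso_tail = fst\<rparr>"
  have "inj_on (map_prod (eta a) (eta a)) (parcs (shuffle_graph a b \<alpha> \<beta>))"
    by (rule inj_on_subset[OF map_prod_inj_on[OF inj inj]]) (auto simp: shuffle_graph_def)
  then have "pre_digraph.digraph_isomorphism ?G h"
    using inj by (auto simp: pre_digraph.digraph_isomorphism_def wf_digraph_def h_def
        shuffle_graph_def)
  moreover have "map_prod (eta a) (eta a) ` parcs (shuffle_graph a b \<alpha> \<beta>)
      = parcs (word_graph (a + b) \<pi>)"
  proof (intro equalityI subsetI)
    fix e assume "e \<in> map_prod (eta a) (eta a) ` parcs (shuffle_graph a b \<alpha> \<beta>)"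
    then show "e \<in> parcs (word_graph (a + b) \<pi>)"
      using move img by (auto simp: shuffle_graph_def word_graph_def)
  next
    fix e assume "e \<in> parcs (word_graph (a + b) \<pi>)"
    then obtain r s where e: "e = (r, s)" "r \<in> ?R" "s \<in> ?R" "word_move r s"
      by (auto simp: word_graph_def)
    \<comment> \<open>Surjectivity on vertices lifts both ends of an arc, and \<open>move\<close>
      then lifts the arc itself.\<close>
    then obtain w x where "w \<in> ?U" "x \<in> ?U" "r = eta a w" "s = eta a x"
      using img by blast
    then show "e \<in> map_prod (eta a) (eta a) ` parcs (shuffle_graph a b \<alpha> \<beta>)"
      using e move by (auto simp: shuffle_graph_def)
  qed
  then have "?H = app_iso h ?G"
    using img by (simp add: app_iso_def with_proj_def h_def shuffle_graph_def word_graph_def)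
  ultimately show "digraph_iso ?G ?H"
    unfolding digraph_iso_def by blast
qed

end
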